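(* Let $G$ be a connected cubic graph. Then $G$ is localizable if and only if $G$ is isomorphic to one of the graphs in $\{K_{3,3},K_4,\overline{C_6}\}\cup\{F_n\mid n\ge 2\}$.
   Context: All graphs are finite, simple and undirected. A graph is cubic if every vertex has degree $3$. A clique is strong if it intersects every maximal independent set; a graph is localizable if its vertex set can be partitioned into strong cliques. $\overline{C_6}$ is the complement of the $6$-cycle. For $n\ge 2$, $F_n$ is the graph with vertex set $\{x_i,x'_i,y_i,y'_i,z_i,z'_i : 1\le i\le n\}$ whose edges are: for each $i$, the triangles $x_iy_iz_i$ and $x'_iy'_iz'_i$ and the edges $y_iy'_i$, $z_iz'_i$; and for each $i$, the edge $x_ix'_{i+1}$, indices taken modulo $n$ (so the last one is $x_nx'_1$). *)

theory Defs
  imports "Graph_Theory.Graph_Theory" "HOL-Library.Disjoint_Sets"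
begin

text \<open>
  A finite simple undirected graph is a term satisfying the library locale
  \<open>graph\<close>: a finite symmetric digraph without loops and multiple arcs, each
  edge being a pair of opposite arcs. The degree of a vertex is therefore its
  out-degree.
\<close>

definition cubic :: "('a, 'b) pre_digraph \<Rightarrow> bool" where
  "cubic G \<longleftrightarrow> (\<forall>v \<in> verts G. out_degree G v = 3)"

definition independent_set :: "('a, 'b) pre_digraph \<Rightarrow> 'a set \<Rightarrow> bool" where
  "independent_set G S \<longleftrightarrow> S \<subseteq> verts G \<and> (\<forall>u \<in> S. \<forall>v \<in> S. \<not> u \<rightarrow>\<^bsub>G\<^esub> v)"

definition maximal_independent_set :: "('a, 'b) pre_digraph \<Rightarrow> 'a set \<Rightarrow> bool" where
  "maximal_independent_set G S \<longleftrightarrow>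
    independent_set G S \<and> (\<forall>T. independent_set G T \<and> S \<subseteq> T \<longrightarrow> T = S)"

definition clique :: "('a, 'b) pre_digraph \<Rightarrow> 'a set \<Rightarrow> bool" where
  "clique G C \<longleftrightarrow> C \<subseteq> verts G \<and> (\<forall>u \<in> C. \<forall>v \<in> C. u \<noteq> v \<longrightarrow> u \<rightarrow>\<^bsub>G\<^esub> v)"

definition strong_clique :: "('a, 'b) pre_digraph \<Rightarrow> 'a set \<Rightarrow> bool" where
  "strong_clique G C \<longleftrightarrow>
    clique G C \<and> (\<forall>S. maximal_independent_set G S \<longrightarrow> C \<inter> S \<noteq> {})"

definition localizable :: "('a, 'b) pre_digraph \<Rightarrow> bool" where
  "localizable G \<longleftrightarrow> (\<exists>P. partition_on (verts G) P \<and> (\<forall>C \<in> P. strong_clique G C))"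

definition complement_graph :: "('a, 'b) pre_digraph \<Rightarrow> 'a pair_pre_digraph" where
  "complement_graph G =
    \<lparr> pverts = verts G,
      parcs = {(u, v). u \<in> verts G \<and> v \<in> verts G \<and> u \<noteq> v \<and> \<not> u \<rightarrow>\<^bsub>G\<^esub> v} \<rparr>"

text \<open>The following is a simple graph, and a cycle, only for \<open>n \<ge> 3\<close>.\<close>

definition cycle_graph :: "nat \<Rightarrow> nat pair_pre_digraph" where
  "cycle_graph n =
    (let E = {(i, Suc i mod n) | i. i < n}
     in \<lparr> pverts = {..<n}, parcs = E \<union> E\<inverse> \<rparr>)"

datatype F_vertex = VX nat | VX' nat | VY nat | VY' nat | VZ nat | VZ' nat

text \<open>
  On the index set \<open>{1..n}\<close>, the cyclic successor of \<open>i\<close> is \<open>i mod n + 1\<close>,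
  so that \<open>n\<close> is followed by \<open>1\<close>.
\<close>

definition F_graph :: "nat \<Rightarrow> F_vertex pair_pre_digraph" where
  "F_graph n =
    (let E = (\<Union>i \<in> {1..n}.
       {(VX i, VY i), (VY i, VZ i), (VX i, VZ i),
        (VX' i, VY' i), (VY' i, VZ' i), (VX' i, VZ' i),
        (VY i, VY' i), (VZ i, VZ' i),
        (VX i, VX' (i mod n + 1))})
     in \<lparr> pverts = (\<Union>i \<in> {1..n}. {VX i, VX' i, VY i, VY' i, VZ i, VZ' i}),
          parcs = E \<union> E\<inverse> \<rparr>)"

lemma finite_complement_arcs:
  assumes "finite (verts G)"
  shows "finite (parcs (complement_graph G))"
  by (rule finite_subset[of _ "verts G \<times> verts G"])
    (use assms in \<open>auto simp: complement_graph_def\<close>)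

lemma pair_graph_complement_graph:
  assumes "graph G"
  shows "pair_graph (complement_graph G)"
proof -
  interpret graph G by (rule assms)
  have s: "u \<rightarrow>\<^bsub>G\<^esub> v \<longleftrightarrow> v \<rightarrow>\<^bsub>G\<^esub> u" for u v
    using sym_arcs by (auto simp: symmetric_def dest: symD)
  show ?thesis
    using finite_complement_arcs[of G] s
    by unfold_locales (auto simp: complement_graph_def symmetric_def intro!: symI)
qed

lemma pair_graph_cycle_graph:
  assumes "n \<ge> 3"
  shows "pair_graph (cycle_graph n)"
proof -
  have eq: "{(i, Suc i mod n) | i. i < n} = (\<lambda>i. (i, Suc i mod n)) ` {..<n}"
    by auto
  have ne: "Suc i mod n \<noteq> i" if "i < n" for i
    using that assms by (cases "Suc i = n") auto
  show ?thesis
    using assms ne ne[symmetric]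
    by unfold_locales
      (auto simp: cycle_graph_def Let_def symmetric_def eq intro!: symI)
qed

lemma pair_graph_F_graph: "pair_graph (F_graph n)"
  by unfold_locales
    (auto simp: F_graph_def Let_def symmetric_def Suc_le_eq intro!: symI)

end

theory Submission
  imports Defs
begin

text \<open>
  In a connected cubic graph a strong clique is not a single vertex, a strong edge forces
  \<open>K\<^bsub>3,3\<^esub>\<close>, and a clique of size at least four is all of \<open>K\<^bsub>4\<^esub>\<close>. Otherwise the graph is
  partitioned into strong triangles, and every vertex has exactly one neighbour outside its
  triangle. A triangle is strong iff two of its three outer neighbours are adjacent, hence lie in
  a common triangle, so that triangles come in pairs joined by at least two edges. If some pair is
  joined by three edges, the graph is the prism, the complement of the 6-cycle. If not, every
  triangle has one remaining vertex, its port, whose outer neighbour is again a port. Alternating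
  between the partner triangle and the outer neighbour runs through the pairs in a cycle, which
  gives \<open>F\<^sub>n\<close>.
\<close>

section \<open>Isomorphisms\<close>

text \<open>Without parallel arcs a vertex bijection determines the arc map that the library notion
  also demands: each arc goes to the pair of images of its ends.\<close>

lemma (in nomulti_digraph) digraph_iso_with_projI:
  assumes bij: "bij_betw g (verts G) (pverts H)"
    and arcs: "\<And>u v. u \<in> verts G \<Longrightarrow> v \<in> verts G \<Longrightarrow> u \<rightarrow> v \<longleftrightarrow> (g u, g v) \<in> parcs H"
    and wf: "parcs H \<subseteq> pverts H \<times> pverts H"
  shows "digraph_iso G (with_proj H)"
proof -
  have inj: "inj_on g (verts G)" and img: "g ` verts G = pverts H"
    using bij by (auto simp: bij_betw_def)
  define h where "h = \<lparr>iso_verts = g, iso_arcs = \<lambda>a. (g (tail G a), g (head G a)),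
    iso_head = snd, iso_tail = fst\<rparr>"
  have "inj_on (iso_arcs h) (arcs G)"
    using inj by (auto simp: h_def inj_on_def arc_to_ends_def intro!: no_multi_arcs)
  then have "digraph_isomorphism h"
    using inj by (auto simp: digraph_isomorphism_def h_def intro: wf_digraph)
  moreover have "iso_arcs h ` arcs G = parcs H"
  proof
    show "iso_arcs h ` arcs G \<subseteq> parcs H"
    proof
      fix e assume "e \<in> iso_arcs h ` arcs G"
      then obtain a where a: "a \<in> arcs G" "e = (g (tail G a), g (head G a))"
        by (auto simp: h_def)
      then have "tail G a \<rightarrow> head G a"
        by (auto simp: arcs_ends_conv)
      then show "e \<in> parcs H"
        using a arcs by simp
    qed
    show "parcs H \<subseteq> iso_arcs h ` arcs G"
    proof
      fix e assume e: "e \<in> parcs H"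
      then have "e \<in> g ` verts G \<times> g ` verts G"
        using wf unfolding img by (rule rev_subsetD)
      then obtain u v where uv: "u \<in> verts G" "v \<in> verts G" "e = (g u, g v)"
        by (elim SigmaE imageE) simp
      then have "u \<rightarrow> v"
        using arcs e by auto
      then show "e \<in> iso_arcs h ` arcs G"
        using uv by (auto simp: h_def arcs_ends_conv)
    qed
  qed
  then have "with_proj H = app_iso h G"
    using img by (simp add: app_iso_def with_proj_def h_def)
  ultimately show ?thesis
    unfolding digraph_iso_def by blast
qed

lemma digraph_isoE:
  assumes "digraph_iso G H"
  obtains h where "bij_betw h (verts G) (verts H)"
    "\<And>u v. u \<in> verts G \<Longrightarrow> v \<in> verts G \<Longrightarrow> u \<rightarrow>\<^bsub>G\<^esub> v \<longleftrightarrow> h u \<rightarrow>\<^bsub>H\<^esub> h v"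
proof -
  obtain f where f: "pre_digraph.digraph_isomorphism G f" and H: "H = app_iso f G"
    using assms by (auto simp: digraph_iso_def)
  interpret wf_digraph G
    using f by (simp add: pre_digraph.digraph_isomorphism_def)
  have inj: "inj_on (iso_verts f) (verts G)"
    using f by (rule digraph_isomorphism_inj_on_verts)
  have ends: "arcs_ends H = (\<lambda>(u, v). (iso_verts f u, iso_verts f v)) ` arcs_ends G"
    using f by (auto simp: H arcs_ends_conv image_image iso_verts_tail iso_verts_head
        intro!: image_cong)
  show ?thesis
  proof
    show "bij_betw (iso_verts f) (verts G) (verts H)"
      using inj by (simp add: bij_betw_def H)
    show "u \<rightarrow>\<^bsub>G\<^esub> v \<longleftrightarrow> iso_verts f u \<rightarrow>\<^bsub>H\<^esub> iso_verts f v"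
      if "u \<in> verts G" "v \<in> verts G" for u v
    proof
      assume "iso_verts f u \<rightarrow>\<^bsub>H\<^esub> iso_verts f v"
      then obtain a b where ab: "(a, b) \<in> arcs_ends G"
        "iso_verts f u = iso_verts f a" "iso_verts f v = iso_verts f b"
        by (auto simp: ends)
      moreover have "a \<in> verts G" "b \<in> verts G"
        using ab(1) by (auto dest: adj_in_verts)
      ultimately show "u \<rightarrow>\<^bsub>G\<^esub> v"
        using that inj by (metis inj_onD)
    qed (force simp: ends)
  qed
qed

text \<open>An independent superset of the preimage has an independent image containing
  \<open>S\<close>; maximality of \<open>S\<close> makes the two equal, and pulling back closes the
  gap.\<close>

lemma maximal_independent_set_vimage:
  assumes bij: "bij_betw h (verts G) (verts H)"
    and adj: "\<And>u v. u \<in> verts G \<Longrightarrow> v \<in> verts G \<Longrightarrow> u \<rightarrow>\<^bsub>G\<^esub> v \<longleftrightarrow> h u \<rightarrow>\<^bsub>H\<^esub> h v"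
    and S: "maximal_independent_set H S"
  shows "maximal_independent_set G (h -` S \<inter> verts G)"
proof -
  have img: "h ` verts G = verts H" and inj: "inj_on h (verts G)"
    using bij by (auto simp: bij_betw_def)
  have ind: "independent_set H S"
    and max: "\<And>T. independent_set H T \<Longrightarrow> S \<subseteq> T \<Longrightarrow> T = S"
    using S by (auto simp: maximal_independent_set_def)
  have "T = h -` S \<inter> verts G"
    if T: "independent_set G T" "h -` S \<inter> verts G \<subseteq> T" for T
  proof -
    have TG: "T \<subseteq> verts G"
      using T by (simp add: independent_set_def)
    have "independent_set H (h ` T)"
      using T(1) img adj by (auto simp: independent_set_def subset_iff)
    moreover have "S \<subseteq> h ` T"
    proof
      fix s assume "s \<in> S"
      moreover from this obtain v where "v \<in> verts G" "s = h v"
        using ind img unfolding independent_set_def by blast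
      ultimately show "s \<in> h ` T" using T(2) by auto
    qed
    ultimately have "h ` T = S" by (rule max)
    then show ?thesis
      using T(2) TG by auto
  qed
  moreover have "independent_set G (h -` S \<inter> verts G)"
    using ind adj by (auto simp: independent_set_def)
  ultimately show ?thesis
    by (simp add: maximal_independent_set_def)
qed

lemma strong_clique_image:
  assumes bij: "bij_betw h (verts G) (verts H)"
    and adj: "\<And>u v. u \<in> verts G \<Longrightarrow> v \<in> verts G \<Longrightarrow> u \<rightarrow>\<^bsub>G\<^esub> v \<longleftrightarrow> h u \<rightarrow>\<^bsub>H\<^esub> h v"
    and C: "strong_clique G C"
  shows "strong_clique H (h ` C)"
proof -
  have CG: "C \<subseteq> verts G" and img: "h ` verts G = verts H"
    using C bij by (auto simp: strong_clique_def clique_def bij_betw_def)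
  have "clique H (h ` C)"
    unfolding clique_def
  proof (intro conjI ballI impI)
    show "h ` C \<subseteq> verts H"
      using CG img by auto
    fix x y assume "x \<in> h ` C" "y \<in> h ` C" "x \<noteq> y"
    then obtain u v where uv: "u \<in> C" "v \<in> C" "u \<noteq> v" "x = h u" "y = h v"
      by auto
    then have "u \<rightarrow>\<^bsub>G\<^esub> v"
      using C by (auto simp: strong_clique_def clique_def)
    then show "x \<rightarrow>\<^bsub>H\<^esub> y"
      using uv adj CG by (simp add: subset_iff)
  qed
  moreover have "h ` C \<inter> S \<noteq> {}" if "maximal_independent_set H S" for S
  proof -
    have "maximal_independent_set G (h -` S \<inter> verts G)"
      using bij adj that by (rule maximal_independent_set_vimage)
    then have "C \<inter> (h -` S \<inter> verts G) \<noteq> {}"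
      using C unfolding strong_clique_def by blast
    then show ?thesis by blast
  qed
  ultimately show ?thesis by (simp add: strong_clique_def)
qed

lemma localizableI:
  assumes "partition_on (verts G) P" "\<And>C. C \<in> P \<Longrightarrow> strong_clique G C"
  shows "localizable G"
  using assms by (auto simp: localizable_def)

lemma localizable_iso:
  assumes "digraph_iso G H" "localizable G"
  shows "localizable H"
proof -
  obtain h where h: "bij_betw h (verts G) (verts H)"
    "\<And>u v. u \<in> verts G \<Longrightarrow> v \<in> verts G \<Longrightarrow> u \<rightarrow>\<^bsub>G\<^esub> v \<longleftrightarrow> h u \<rightarrow>\<^bsub>H\<^esub> h v"
    using assms(1) by (rule digraph_isoE) blast
  obtain P where P: "partition_on (verts G) P" "\<And>C. C \<in> P \<Longrightarrow> strong_clique G C"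
    using assms(2) by (auto simp: localizable_def)
  have "partition_on (verts H) ((`) h ` P)"
  proof -
    \<comment> \<open>The rule for images of partitions removes an empty part; nonempty parts have
      nonempty images, so here it removes nothing.\<close>
    have "(`) h ` P - {{}} = (`) h ` P"
      using P(1) by (auto simp: partition_on_def)
    then show ?thesis
      using partition_on_inj_image[OF P(1), of h] h(1) by (simp add: bij_betw_def)
  qed
  then show ?thesis
    using strong_clique_image[OF h] P(2) by (auto intro: localizableI)
qed

section \<open>Strong cliques\<close>

context graph
begin

lemma adj_sym: "u \<rightarrow> v \<Longrightarrow> v \<rightarrow> u"
  using sym_arcs by (auto simp: symmetric_def elim: symE)

lemma adj_irrefl [simp]: "\<not> v \<rightarrow> v"
  using adj_not_same by blast

text \<open>Sufficient criterion. A maximal independent set missing \<open>C\<close> would contain a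
  neighbour of every vertex of \<open>C\<close>; those of \<open>y\<close> and \<open>z\<close> lie
  outside \<open>C\<close>, so they are adjacent by \<open>cover\<close>, which contradicts
  independence.\<close>

lemma strong_cliqueI:
  assumes C: "clique G C" and "y \<in> C" "z \<in> C"
    and cover: "\<And>u v. y \<rightarrow> u \<Longrightarrow> u \<notin> C \<Longrightarrow> z \<rightarrow> v \<Longrightarrow> v \<notin> C \<Longrightarrow> u \<rightarrow> v"
  shows "strong_clique G C"
proof -
  have "C \<inter> S \<noteq> {}" if S: "maximal_independent_set G S" for S
  proof
    assume disj: "C \<inter> S = {}"
    have ind: "independent_set G S"
      using S by (simp add: maximal_independent_set_def)
    have *: "\<exists>u \<in> S. c \<rightarrow> u" if "c \<in> C" for c
    proof (rule ccontr)
      assume "\<not> (\<exists>u \<in> S. c \<rightarrow> u)"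
      then have "independent_set G (insert c S)"
        using ind that C adj_sym by (auto simp: independent_set_def clique_def)
      then have "insert c S = S"
        using S unfolding maximal_independent_set_def by blast
      then show False using that disj by auto
    qed
    obtain u v where "u \<in> S" "y \<rightarrow> u" "v \<in> S" "z \<rightarrow> v"
      using *[OF assms(2)] *[OF assms(3)] by blast
    moreover from this have "u \<notin> C" "v \<notin> C"
      using disj by auto
    ultimately show False
      using cover[of u v] ind by (auto simp: independent_set_def)
  qed
  then show ?thesis using C by (simp add: strong_clique_def)
qed

lemma maximal_independent_supersetE:
  assumes "independent_set G I"
  obtains M where "maximal_independent_set G M" "I \<subseteq> M"
proof -
  let ?A = "{T. independent_set G T \<and> I \<subseteq> T}"
  have "finite ?A"
    by (rule finite_subset[of _ "Pow (verts G)"]) (auto simp: independent_set_def)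
  moreover have "?A \<noteq> {}" using assms by auto
  ultimately have "\<exists>M \<in> ?A. \<forall>T \<in> ?A. M \<subseteq> T \<longrightarrow> M = T"
    by (rule finite_has_maximal)
  then obtain M where M: "M \<in> ?A" "\<forall>T \<in> ?A. M \<subseteq> T \<longrightarrow> M = T" ..
  have "maximal_independent_set G M"
    unfolding maximal_independent_set_def
  proof (intro conjI allI impI)
    fix T assume T: "independent_set G T \<and> M \<subseteq> T"
    then have "T \<in> ?A" using M(1) by auto
    then show "T = M" using T M(2) by auto
  qed (use M(1) in simp)
  then show ?thesis
    using M(1) by (intro that) auto
qed

text \<open>Necessary criterion. If the chosen neighbours were independent, a maximal independent
  set containing them would meet \<open>C\<close> in some \<open>c\<close>, although it also
  contains \<open>s c\<close>.\<close>

lemma strong_cliqueD: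
  assumes C: "strong_clique G C" and s: "\<And>c. c \<in> C \<Longrightarrow> c \<rightarrow> s c"
  shows "\<exists>a \<in> C. \<exists>b \<in> C. s a \<rightarrow> s b"
proof (rule ccontr)
  assume "\<not> ?thesis"
  then have "independent_set G (s ` C)"
    unfolding independent_set_def using s adj_in_verts(2) by blast
  then obtain M where M: "maximal_independent_set G M" "s ` C \<subseteq> M"
    by (rule maximal_independent_supersetE)
  then obtain c where "c \<in> C" "c \<in> M"
    using C unfolding strong_clique_def by blast
  then show False
    using M s[of c] unfolding maximal_independent_set_def independent_set_def by blast
qed

end

section \<open>The listed graphs are localizable\<close>

lemma localizable_complete:
  assumes "K\<^bsub>n\<^esub> G" "n > 0"
  shows "localizable G"
proof -
  interpret graph G using assms by (simp add: complete_digraph_def)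
  obtain v where "v \<in> verts G"
    using assms by (metis complete_digraph_def card.empty less_irrefl all_not_in_conv)
  moreover have "clique G (verts G)"
    using assms by (auto simp: complete_digraph_def clique_def)
  ultimately have "strong_clique G (verts G)"
    \<comment> \<open>With the whole vertex set as clique nothing lies outside, so the covering
      condition is vacuous and one vertex can serve as both \<open>y\<close> and
      \<open>z\<close>.\<close>
    by (intro strong_cliqueI[of _ v v]) (auto dest: adj_in_verts)
  moreover have part: "partition_on (verts G) {verts G}"
    using \<open>v \<in> verts G\<close> by (auto intro!: partition_onI)
  ultimately show ?thesis by (auto intro: localizableI[OF part])
qed

text \<open>A bijection between the sides is a perfect matching. Each of its edges is strong: the
  remaining neighbours of its two ends lie on opposite sides and are thus adjacent.\<close>

lemma localizable_complete_bipartite: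
  assumes "K\<^bsub>n,n\<^esub> G"
  shows "localizable G"
proof -
  interpret graph G using assms by (simp add: complete_bipartite_digraph_def)
  obtain U V where UV: "verts G = U \<union> V" "U \<inter> V = {}" "card U = n" "card V = n"
    and arcs: "arcs_ends G = U \<times> V \<union> V \<times> U"
    using assms by (auto simp: complete_bipartite_digraph_def)
  have "finite U" "finite V"
    using UV(1) finite_verts by (metis finite_Un)+
  then obtain g where g: "bij_betw g U V"
    using UV finite_same_card_bij by metis
  then have gV: "g u \<in> V" if "u \<in> U" for u
    using that by (auto simp: bij_betw_def)
  have "strong_clique G {u, g u}" if u: "u \<in> U" for u
    using u gV[OF u] UV(2) arcs UV(1)
    by (intro strong_cliqueI[of _ u "g u"]) (auto simp: clique_def)
  moreover have part: "partition_on (verts G) ((\<lambda>u. {u, g u}) ` U)"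
  proof (rule partition_onI)
    show "\<Union> ((\<lambda>u. {u, g u}) ` U) = verts G"
      using g UV(1) by (auto simp: bij_betw_def)
    fix p q assume "p \<in> (\<lambda>u. {u, g u}) ` U" "q \<in> (\<lambda>u. {u, g u}) ` U" "p \<noteq> q"
    then show "disjnt p q"
      using gV UV(2) g by (auto simp: disjnt_def bij_betw_def dest: inj_onD)
  qed auto
  ultimately show ?thesis by (auto intro: localizableI[OF part])
qed

abbreviation "complement_C6 \<equiv> complement_graph (with_proj (cycle_graph 6))"

lemma pverts_complement_C6: "pverts complement_C6 = {0, 1, 2, 3, 4, 5}"
  by (auto simp: complement_graph_def cycle_graph_def Let_def)

lemma parcs_complement_C6:
  "parcs complement_C6 = {(0, 2), (0, 3), (0, 4), (1, 3), (1, 4), (1, 5), (2, 0), (2, 4), (2, 5),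
     (3, 0), (3, 1), (3, 5), (4, 0), (4, 1), (4, 2), (5, 1), (5, 2), (5, 3)}" (is "_ = ?E")
proof -
  have "(u, v) \<in> parcs complement_C6 \<longleftrightarrow>
      u < 6 \<and> v < 6 \<and> u \<noteq> v \<and> v \<noteq> Suc u mod 6 \<and> u \<noteq> Suc v mod 6" for u v
    by (auto simp: complement_graph_def cycle_graph_def Let_def)
  \<comment> \<open>As a filter over an explicit finite product the arc set can be computed by
    evaluation.\<close>
  then have "parcs complement_C6 = Set.filter (\<lambda>(u, v).
      u \<noteq> v \<and> v \<noteq> Suc u mod 6 \<and> u \<noteq> Suc v mod 6) ({0..<6} \<times> {0..<6})"
    by (auto simp del: mod_Suc)
  also have "\<dots> = ?E"
    by code_simp
  finally show ?thesis .
qed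

text \<open>The even and the odd residues form the two triangles of the prism, and \<open>i\<close>
  is matched with its antipode modulo 6. The outer neighbours 3, 5 of 0, 2 are adjacent, as are the
  outer neighbours 4, 0 of 1, 3.\<close>

lemma localizable_complement_C6: "localizable (with_proj complement_C6)"
proof -
  interpret graph "with_proj complement_C6"
    using pair_graph_complement_graph[OF pair_graph.pair_graphD_graph[OF pair_graph_cycle_graph[of 6]]]
    by (simp add: pair_graph.pair_graphD_graph)
  have "strong_clique (with_proj complement_C6) {0, 2, 4}"
    by (intro strong_cliqueI[of _ 0 2])
      (auto simp: clique_def pverts_complement_C6 parcs_complement_C6)
  moreover have "strong_clique (with_proj complement_C6) {1, 3, 5}"
    by (intro strong_cliqueI[of _ 1 3])
      (auto simp: clique_def pverts_complement_C6 parcs_complement_C6)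
  moreover have part: "partition_on (verts (with_proj complement_C6)) {{0, 2, 4}, {1, 3, 5}}"
    by (auto simp: partition_on_def disjoint_def pverts_complement_C6)
  ultimately show ?thesis by (auto intro: localizableI[OF part])
qed

lemma pverts_F: "pverts (F_graph n) =
    (\<Union>i \<in> {1..n}. {VX i, VX' i, VY i, VY' i, VZ i, VZ' i})"
  by (simp add: F_graph_def Let_def)

text \<open>Only the clause for \<open>VX'\<close> is existential: its outer edge leads to the
  cyclic predecessor of the index, while the definition speaks of successors.\<close>

lemma parcs_F:
  "(VX i, v) \<in> parcs (F_graph n) \<longleftrightarrow> i \<in> {1..n} \<and> v \<in> {VY i, VZ i, VX' (i mod n + 1)}"
  "(VY i, v) \<in> parcs (F_graph n) \<longleftrightarrow> i \<in> {1..n} \<and> v \<in> {VX i, VZ i, VY' i}"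
  "(VZ i, v) \<in> parcs (F_graph n) \<longleftrightarrow> i \<in> {1..n} \<and> v \<in> {VX i, VY i, VZ' i}"
  "(VX' i, v) \<in> parcs (F_graph n) \<longleftrightarrow>
    i \<in> {1..n} \<and> v \<in> {VY' i, VZ' i} \<or> (\<exists>j \<in> {1..n}. i = j mod n + 1 \<and> v = VX j)"
  "(VY' i, v) \<in> parcs (F_graph n) \<longleftrightarrow> i \<in> {1..n} \<and> v \<in> {VX' i, VZ' i, VY i}"
  "(VZ' i, v) \<in> parcs (F_graph n) \<longleftrightarrow> i \<in> {1..n} \<and> v \<in> {VX' i, VY' i, VZ i}"
  by (cases v; simp add: F_graph_def Let_def; blast)+

text \<open>The triangles of block \<open>i\<close> certify each other: the outer neighbours of the
  \<open>y\<close> and \<open>z\<close> vertices of one are adjacent in the other.\<close>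

lemma localizable_F: "localizable (with_proj (F_graph n))"
proof -
  interpret graph "with_proj (F_graph n)"
    using pair_graph_F_graph by (rule pair_graph.pair_graphD_graph)
  have "strong_clique (with_proj (F_graph n)) {VX i, VY i, VZ i}" if "i \<in> {1..n}" for i
    using that by (intro strong_cliqueI[of _ "VY i" "VZ i"])
      (auto simp: clique_def parcs_F pverts_F)
  moreover have "strong_clique (with_proj (F_graph n)) {VX' i, VY' i, VZ' i}" if "i \<in> {1..n}" for i
    using that by (intro strong_cliqueI[of _ "VY' i" "VZ' i"])
      (auto simp: clique_def parcs_F pverts_F)
  moreover have part: "partition_on (verts (with_proj (F_graph n)))
      ((\<lambda>i. {VX i, VY i, VZ i}) ` {1..n} \<union> (\<lambda>i. {VX' i, VY' i, VZ' i}) ` {1..n})"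
  proof (rule partition_onI)
    show "\<Union> ((\<lambda>i. {VX i, VY i, VZ i}) ` {1..n} \<union> (\<lambda>i. {VX' i, VY' i, VZ' i}) ` {1..n}) =
        verts (with_proj (F_graph n))"
      by (auto simp: pverts_F)
  qed (auto simp: disjnt_def)
  ultimately show ?thesis by (auto intro: localizableI[OF part])
qed

section \<open>Connected cubic graphs\<close>

definition neighbours :: "('a, 'b) pre_digraph \<Rightarrow> 'a \<Rightarrow> 'a set" where
  "neighbours G v = {w. v \<rightarrow>\<^bsub>G\<^esub> w}"

lemma in_neighbours_iff: "w \<in> neighbours G v \<longleftrightarrow> v \<rightarrow>\<^bsub>G\<^esub> w"
  by (simp add: neighbours_def)

lemma card_3_extendE:
  assumes "card N = 3" "a \<in> N" "b \<in> N" "a \<noteq> b"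
  obtains c where "N = {a, b, c}" "c \<noteq> a" "c \<noteq> b"
proof -
  have "card (N - {a, b}) = 1"
    using assms by (subst card_Diff_subset) auto
  then obtain c where "N - {a, b} = {c}"
    by (auto simp: card_1_singleton_iff)
  then show ?thesis
    using assms(2,3) by (intro that[of c]) auto
qed

lemma card_3_containsE:
  assumes "card N = 3" "a \<in> N"
  obtains b c where "N = {a, b, c}" "a \<noteq> b" "a \<noteq> c" "b \<noteq> c"
proof -
  have "card (N - {a}) = 2"
    using assms by (subst card_Diff_subset) auto
  then obtain b c where "N - {a} = {b, c}" "b \<noteq> c"
    by (auto simp: card_2_iff)
  then show ?thesis
    using assms(2) by (intro that[of b c]) auto
qed

lemma card_3_eqI:
  assumes "card N = 3" "a \<in> N" "b \<in> N" "c \<in> N" "a \<noteq> b" "a \<noteq> c" "b \<noteq> c"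
  shows "N = {a, b, c}"
proof -
  have "finite N"
    using assms(1) by (metis card.infinite zero_neq_numeral)
  then have "{a, b, c} = N"
    using assms by (intro card_subset_eq) auto
  then show ?thesis ..
qed

locale connected_cubic_graph = graph +
  assumes connected: "connected G" and cubic: "cubic G"
begin

lemma card_neighbours: "v \<in> verts G \<Longrightarrow> card (neighbours G v) = 3"
proof -
  assume v: "v \<in> verts G"
  have "inj_on (head G) (out_arcs G v)"
    by (rule inj_onI) (auto simp: arc_to_ends_def intro!: no_multi_arcs)
  moreover have "neighbours G v = head G ` out_arcs G v"
    by (auto simp: neighbours_def arcs_ends_conv)
  ultimately show ?thesis
    using v cubic by (simp add: card_image cubic_def out_degree_def)
qed

text \<open>The only use of connectedness beyond nonemptiness: a local configuration that contains
  all its neighbours is already the whole graph.\<close>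

lemma closed_eq_verts:
  assumes "v \<in> S" "S \<subseteq> verts G" and closed: "\<And>u. u \<in> S \<Longrightarrow> neighbours G u \<subseteq> S"
  shows "S = verts G"
proof
  show "verts G \<subseteq> S"
  proof
    fix w assume "w \<in> verts G"
    moreover have "strongly_connected G"
      using sym_arcs connected by (rule symmetric_connected_imp_strongly_connected)
    ultimately have "v \<rightarrow>\<^sup>* w"
      using assms(1,2) by (auto simp: strongly_connected_def)
    then show "w \<in> S"
    proof (induction rule: reachable_induct)
      case base
      show ?case by (rule assms(1))
    next
      case (step x y)
      then show ?case
        using closed[of x] by (auto simp: in_neighbours_iff)
    qed
  qed
qed (rule assms(2))

text \<open>The map runs from the model \<open>H\<close> into \<open>G\<close>. Covering all
  neighbours makes its image closed, hence everything; the isomorphism is the inverse map. Only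
  neighbourhoods of single vertices have to be compared.\<close>

lemma digraph_isoI:
  assumes wf: "parcs H \<subseteq> pverts H \<times> pverts H" and ne: "pverts H \<noteq> {}"
    and inj: "inj_on f (pverts H)" and img: "f ` pverts H \<subseteq> verts G"
    and hom: "\<And>u v. (u, v) \<in> parcs H \<Longrightarrow> f u \<rightarrow> f v"
    and cover: "\<And>u. u \<in> pverts H \<Longrightarrow> neighbours G (f u) \<subseteq> f ` {v. (u, v) \<in> parcs H}"
  shows "digraph_iso G (with_proj H)"
proof -
  obtain u0 where "u0 \<in> pverts H" using ne by auto
  have "f ` pverts H = verts G"
  proof (rule closed_eq_verts)
    show "f u0 \<in> f ` pverts H" using \<open>u0 \<in> pverts H\<close> by simp
    show "neighbours G u \<subseteq> f ` pverts H" if "u \<in> f ` pverts H" for u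
      using that cover wf by fast
  qed (rule img)
  then have bij: "bij_betw f (pverts H) (verts G)"
    using inj by (simp add: bij_betw_def)
  let ?g = "the_inv_into (pverts H) f"
  \<comment> \<open>Adjacency is reflected because every neighbour of \<open>f u\<close> is the
    image of an \<open>H\<close>-neighbour of \<open>u\<close>, and injectivity identifies that
    vertex with \<open>v\<close>.\<close>
  have adj: "f u \<rightarrow> f v \<longleftrightarrow> (u, v) \<in> parcs H" if uv: "u \<in> pverts H" "v \<in> pverts H" for u v
  proof
    assume "f u \<rightarrow> f v"
    then obtain w where w: "(u, w) \<in> parcs H" "f v = f w"
      using cover[OF uv(1)] by (auto simp: in_neighbours_iff subset_iff image_iff)
    then have "v = w"
      using inj uv wf by (auto dest: inj_onD)
    then show "(u, v) \<in> parcs H" using w by simp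
  qed (rule hom)
  show ?thesis
  proof (rule digraph_iso_with_projI)
    show bij': "bij_betw ?g (verts G) (pverts H)"
      using bij by (rule bij_betw_the_inv_into)
    fix u v assume uv: "u \<in> verts G" "v \<in> verts G"
    moreover have "f (?g u) = u" "f (?g v) = v"
      using uv bij by (simp_all add: f_the_inv_into_f_bij_betw)
    moreover have "?g u \<in> pverts H" "?g v \<in> pverts H"
      using uv bij' by (simp_all add: bij_betwE)
    ultimately show "u \<rightarrow> v \<longleftrightarrow> (?g u, ?g v) \<in> parcs H"
      using adj[of "?g u" "?g v"] by simp
  qed (rule wf)
qed

section \<open>Strong cliques of size one or two, and cliques of size at least four\<close>

lemma arcs_ends_bipartite:
  assumes "verts G = U \<union> W" "U \<inter> W = {}"
    and U: "\<And>u. u \<in> U \<Longrightarrow> neighbours G u = W" and W: "\<And>w. w \<in> W \<Longrightarrow> neighbours G w = U"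
  shows "arcs_ends G = U \<times> W \<union> W \<times> U"
proof (intro set_eqI, clarify)
  fix a b
  show "a \<rightarrow> b \<longleftrightarrow> (a, b) \<in> U \<times> W \<union> W \<times> U"
    using assms(1,2) U[of a] W[of a] adj_in_verts(1)[of a b]
    unfolding in_neighbours_iff[symmetric] by blast
qed

lemma strong_clique_card_ne_1:
  assumes "strong_clique G C"
  shows "card C \<noteq> 1"
proof
  assume "card C = 1"
  then obtain u where C: "C = {u}" by (auto simp: card_1_singleton_iff)
  then have "u \<in> verts G"
    using assms by (simp add: strong_clique_def clique_def)
  then have "neighbours G u \<noteq> {}"
    using card_neighbours by force
  then obtain w where "u \<rightarrow> w" by (auto simp: neighbours_def)
  then show False
    using strong_cliqueD[OF assms, of "\<lambda>_. w"] C by simp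
qed

text \<open>Strength of the edge joins every other neighbour of \<open>u\<close> to every other
  neighbour of \<open>v\<close>. All six vertices then have degree three, so they form a closed
  set.\<close>

lemma strong_edge_imp_K33:
  assumes C: "strong_clique G C" and card: "card C = 2"
  shows "K\<^bsub>3,3\<^esub> G"
proof -
  obtain u v where uv: "C = {u, v}" "u \<noteq> v"
    using card by (auto simp: card_2_iff)
  have V: "u \<in> verts G" "v \<in> verts G" and "u \<rightarrow> v" "v \<rightarrow> u"
    using C uv by (auto simp: strong_clique_def clique_def)
  obtain u1 u2 where Nu: "neighbours G u = {v, u1, u2}" and u: "v \<noteq> u1" "v \<noteq> u2" "u1 \<noteq> u2"
    using card_neighbours[OF V(1)] \<open>u \<rightarrow> v\<close>
    by (elim card_3_containsE[of _ v]) (auto simp: in_neighbours_iff)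
  obtain v1 v2 where Nv: "neighbours G v = {u, v1, v2}" and v: "u \<noteq> v1" "u \<noteq> v2" "v1 \<noteq> v2"
    using card_neighbours[OF V(2)] \<open>v \<rightarrow> u\<close>
    by (elim card_3_containsE[of _ u]) (auto simp: in_neighbours_iff)
  have Nu': "u \<rightarrow> x \<longleftrightarrow> x \<in> {v, u1, u2}" for x
    using Nu by (auto simp: neighbours_def)
  have Nv': "v \<rightarrow> x \<longleftrightarrow> x \<in> {u, v1, v2}" for x
    using Nv by (auto simp: neighbours_def)
  have join: "a \<rightarrow> b" "b \<rightarrow> a" if "a \<in> {u1, u2}" "b \<in> {v1, v2}" for a b
  proof -
    \<comment> \<open>The chosen neighbours are \<open>a\<close> for \<open>u\<close> and
      \<open>b\<close> for \<open>v\<close>; as there are no loops, the adjacent pair must consist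
      of \<open>a\<close> and \<open>b\<close>.\<close>
    have "\<exists>c \<in> C. \<exists>d \<in> C. (if c = u then a else b) \<rightarrow> (if d = u then a else b)"
      using C by (rule strong_cliqueD) (use that uv Nu' Nv' in auto)
    then show "a \<rightarrow> b" "b \<rightarrow> a"
      using uv adj_sym by (auto split: if_splits)
  qed
  have V': "u1 \<in> verts G" "u2 \<in> verts G" "v1 \<in> verts G" "v2 \<in> verts G"
    using Nu' Nv' adj_in_verts(2)[of u] adj_in_verts(2)[of v] by simp_all
  have N1: "neighbours G a = {u, v1, v2}" if "a \<in> {u1, u2}" for a
    using that v V' join adj_sym[of u] Nu'
    by (intro card_3_eqI) (auto simp: in_neighbours_iff card_neighbours)
  have N2: "neighbours G b = {v, u1, u2}" if "b \<in> {v1, v2}" for b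
    using that u V' join adj_sym[of v] Nv'
    by (intro card_3_eqI) (auto simp: in_neighbours_iff card_neighbours)
  let ?U = "{u, v1, v2}" and ?W = "{v, u1, u2}"
  have ne: "u \<noteq> u1" "u \<noteq> u2" "v \<noteq> v1" "v \<noteq> v2"
    using Nu'[of u] Nv'[of v] by auto
  have disj: "?U \<inter> ?W = {}"
  proof -
    have "u1 \<noteq> v1" "u1 \<noteq> v2" "u2 \<noteq> v1" "u2 \<noteq> v2"
      using join(1)[of u1 v1] join(1)[of u1 v2] join(1)[of u2 v1] join(1)[of u2 v2] by auto
    then show ?thesis using ne uv(2) by simp
  qed
  have NU: "neighbours G x = ?W" if "x \<in> ?U" for x
    using that Nu N2 by auto
  have NW: "neighbours G x = ?U" if "x \<in> ?W" for x
    using that Nv N1 by auto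
  have verts: "?U \<union> ?W = verts G"
  proof (rule closed_eq_verts)
    show "neighbours G x \<subseteq> ?U \<union> ?W" if "x \<in> ?U \<union> ?W" for x
      using that NU[of x] NW[of x] by auto
  qed (use V V' in auto)
  have arcs: "arcs_ends G = ?U \<times> ?W \<union> ?W \<times> ?U"
    using verts[symmetric] disj NU NW by (rule arcs_ends_bipartite)
  have "card ?U = 3" "card ?W = 3"
    using u v by auto
  then show ?thesis
    unfolding complete_bipartite_digraph_def
    using graph_axioms verts[symmetric] disj arcs by (intro conjI exI[of _ ?U] exI[of _ ?W])
qed

lemma clique_subset_neighbours:
  assumes C: "clique G C" and v: "v \<in> C"
  shows "C \<subseteq> insert v (neighbours G v)"
proof
  fix w assume "w \<in> C"
  then show "w \<in> insert v (neighbours G v)"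
    using assms by (cases "w = v") (simp_all add: clique_def in_neighbours_iff)
qed

text \<open>A clique lies in the closed neighbourhood of each of its vertices, which has four
  elements. So it equals each of them and is closed under taking neighbours.\<close>

lemma clique_4_imp_K4:
  assumes C: "clique G C" and card: "card C \<ge> 4"
  shows "K\<^bsub>4\<^esub> G"
proof -
  have CV: "C \<subseteq> verts G"
    using C by (simp add: clique_def)
  have eq: "C = insert v (neighbours G v)" and card_C: "card C = 4" if v: "v \<in> C" for v
  proof -
    have *: "card (insert v (neighbours G v)) = 4" "finite (neighbours G v)"
      using v CV card_neighbours[of v]
      by (auto simp: card_insert_if in_neighbours_iff card_ge_0_finite)
    then have "card C = 4"
      using card card_mono[OF _ clique_subset_neighbours[OF C v]] by simp
    then show "C = insert v (neighbours G v)" "card C = 4"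
      using * clique_subset_neighbours[OF C v] card_subset_eq[of "insert v (neighbours G v)" C] by simp_all
  qed
  obtain v where "v \<in> C"
    using card by fastforce
  then have verts: "C = verts G"
    using CV eq by (intro closed_eq_verts) auto
  then have "arcs_ends G = {(u, v). (u, v) \<in> verts G \<times> verts G \<and> u \<noteq> v}"
  proof (intro set_eqI, clarify)
    fix a b
    show "a \<rightarrow> b \<longleftrightarrow> (a, b) \<in> {(u, v). (u, v) \<in> verts G \<times> verts G \<and> u \<noteq> v}"
    proof
      assume "a \<rightarrow> b"
      then have "a \<in> verts G" "b \<in> verts G" "a \<noteq> b"
        using adj_irrefl by (auto dest: adj_in_verts)
      then show "(a, b) \<in> {(u, v). (u, v) \<in> verts G \<times> verts G \<and> u \<noteq> v}" by simp
    qed (use C verts in \<open>simp add: clique_def\<close>)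
  qed
  then show ?thesis
    unfolding complete_digraph_def
    using card_C[OF \<open>v \<in> C\<close>] verts graph_axioms by blast
qed

end

section \<open>Partitions into strong triangles\<close>

locale triangle_partition = connected_cubic_graph +
  fixes P
  assumes part: "partition_on (verts G) P"
    and strong: "C \<in> P \<Longrightarrow> strong_clique G C"
    and card_triangle: "C \<in> P \<Longrightarrow> card C = 3"
begin

definition triangle :: "'a \<Rightarrow> 'a set" where
  "triangle v = (THE C. C \<in> P \<and> v \<in> C)"

text \<open>In a cubic graph two of the three neighbours of a vertex are the rest of its triangle,
  so exactly one is left.\<close>

definition outer :: "'a \<Rightarrow> 'a" where
  "outer v = (THE w. v \<rightarrow>\<^bsub>G\<^esub> w \<and> w \<notin> triangle v)"

lemma triangle_eqI:
  assumes "C \<in> P" "v \<in> C"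
  shows "triangle v = C"
  unfolding triangle_def
proof (rule the_equality)
  show "D = C" if "D \<in> P \<and> v \<in> D" for D
    using that assms part by (auto simp: partition_on_def disjoint_def)
qed (use assms in simp)

lemma triangle_in_P: "v \<in> verts G \<Longrightarrow> triangle v \<in> P"
  and self_in_triangle: "v \<in> verts G \<Longrightarrow> v \<in> triangle v"
proof -
  assume "v \<in> verts G"
  then obtain C where "C \<in> P" "v \<in> C"
    using part by (auto simp: partition_on_def)
  then show "triangle v \<in> P" "v \<in> triangle v"
    by (simp_all add: triangle_eqI)
qed

lemma triangle_subset_verts: "v \<in> verts G \<Longrightarrow> triangle v \<subseteq> verts G"
  using triangle_in_P part by (auto simp: partition_on_def)

lemma triangle_eq: "v \<in> verts G \<Longrightarrow> u \<in> triangle v \<Longrightarrow> triangle u = triangle v"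
  by (rule triangle_eqI) (rule triangle_in_P)

lemma neighbours_triangle:
  assumes v: "v \<in> verts G"
  obtains w where "neighbours G v = insert w (triangle v - {v})" "w \<notin> triangle v"
proof -
  have card: "card (triangle v) = 3" "card (neighbours G v) = 3"
    using v by (simp_all add: card_triangle triangle_in_P card_neighbours)
  have "clique G (triangle v)"
    using strong[OF triangle_in_P[OF v]] by (simp add: strong_clique_def)
  then have sub: "triangle v - {v} \<subseteq> neighbours G v"
    using clique_subset_neighbours[OF _ self_in_triangle[OF v]] by auto
  have "card (triangle v - {v}) = 2"
    using card(1) self_in_triangle[OF v] by simp
  moreover have "finite (triangle v)"
    using card(1) by (auto intro: card_ge_0_finite)
  ultimately have "card (neighbours G v - (triangle v - {v})) = 1"
    using sub card(2) by (simp add: card_Diff_subset)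
  then obtain w where w: "neighbours G v - (triangle v - {v}) = {w}"
    by (auto simp: card_1_singleton_iff)
  then have "w \<in> neighbours G v" by auto
  then have "w \<noteq> v" by (auto simp: in_neighbours_iff)
  show ?thesis
  proof
    show "neighbours G v = insert w (triangle v - {v})" using w sub by blast
    show "w \<notin> triangle v" using w \<open>w \<noteq> v\<close> by blast
  qed
qed

lemma neighbours_eq: "v \<in> verts G \<Longrightarrow> neighbours G v = insert (outer v) (triangle v - {v})"
  and outer_notin_triangle: "v \<in> verts G \<Longrightarrow> outer v \<notin> triangle v"
proof -
  assume "v \<in> verts G"
  then obtain w where w: "neighbours G v = insert w (triangle v - {v})" "w \<notin> triangle v"
    by (rule neighbours_triangle)
  have "outer v = w"
    unfolding outer_def in_neighbours_iff[symmetric] w(1)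
    using w(2) by (intro the_equality) auto
  then show "neighbours G v = insert (outer v) (triangle v - {v})" "outer v \<notin> triangle v"
    using w by auto
qed

lemma adj_outer: "v \<in> verts G \<Longrightarrow> v \<rightarrow> outer v"
  by (simp add: in_neighbours_iff[symmetric] neighbours_eq)

lemma outer_in_verts [simp]: "v \<in> verts G \<Longrightarrow> outer v \<in> verts G"
  by (rule adj_in_verts(2)[OF adj_outer])

lemma triangle_outer_ne: "v \<in> verts G \<Longrightarrow> triangle (outer v) \<noteq> triangle v"
  using outer_notin_triangle[of v] self_in_triangle[of "outer v"] by auto

text \<open>The vertex \<open>v\<close> is a neighbour of \<open>outer v\<close> in another
  triangle, and there is only one such neighbour. Hence the outer edges form a perfect
  matching.\<close>

lemma outer_outer [simp]:
  assumes v: "v \<in> verts G"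
  shows "outer (outer v) = v"
proof -
  have "v \<in> neighbours G (outer v)"
    using adj_outer[OF v] adj_sym by (simp add: in_neighbours_iff)
  moreover have "v \<notin> triangle (outer v)"
    using triangle_eq[of "outer v" v] triangle_outer_ne[of v] v by auto
  ultimately show ?thesis
    using v by (simp add: neighbours_eq)
qed

lemma outer_eq_iff: "u \<in> verts G \<Longrightarrow> v \<in> verts G \<Longrightarrow> outer u = outer v \<longleftrightarrow> u = v"
  by (metis outer_outer)

text \<open>Strength makes two outer neighbours \<open>outer a\<close> and \<open>outer b\<close>
  adjacent. This edge is not an outer edge, since the outer edge at \<open>outer a\<close> ends in
  \<open>a\<close>; so it lies inside one triangle.\<close>

lemma twin_outerE:
  assumes C: "C \<in> P"
  obtains a b where "a \<in> C" "b \<in> C" "a \<noteq> b" "triangle (outer a) = triangle (outer b)"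
proof -
  have CV: "c \<in> verts G" "triangle c = C" if "c \<in> C" for c
    using that C part by (auto simp: partition_on_def triangle_eqI)
  have "\<exists>a \<in> C. \<exists>b \<in> C. outer a \<rightarrow> outer b"
    by (rule strong_cliqueD[OF strong[OF C]]) (simp add: CV adj_outer)
  then obtain a b where ab: "a \<in> C" "b \<in> C" "outer a \<rightarrow> outer b"
    by (elim bexE)
  then have "outer b \<in> neighbours G (outer a)"
    by (simp add: in_neighbours_iff)
  moreover have "outer b \<noteq> a"
    using outer_notin_triangle[of b] ab(1,2) CV by auto
  ultimately have "outer b \<in> triangle (outer a)"
    using ab(1,2) CV by (simp add: neighbours_eq)
  then have "triangle (outer a) = triangle (outer b)"
    using ab(1,2) CV triangle_eq[of "outer a" "outer b"] by simp
  moreover have "a \<noteq> b" using ab(3) by auto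
  ultimately show ?thesis using ab that by blast
qed

lemma triangle_vertsD:
  assumes "v \<in> verts G" "triangle v = {a, b, c}"
  shows "a \<in> verts G" "b \<in> verts G" "c \<in> verts G"
    "triangle a = {a, b, c}" "triangle b = {a, b, c}" "triangle c = {a, b, c}"
  using assms triangle_subset_verts[of v] triangle_eq[of v] by auto

lemma prism_iso_complement_C6:
  assumes C: "{a, b, c} \<in> P" and dist: "a \<noteq> b" "a \<noteq> c" "b \<noteq> c"
    and same: "triangle (outer b) = triangle (outer a)" "triangle (outer c) = triangle (outer a)"
  shows "digraph_iso G (with_proj complement_C6)"
proof -
  have V: "a \<in> verts G" "b \<in> verts G" "c \<in> verts G"
    using C part by (auto simp: partition_on_def)
  have T: "triangle a = {a, b, c}" "triangle b = {a, b, c}" "triangle c = {a, b, c}"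
    using triangle_eqI[OF C] by simp_all
  have dist': "outer a \<noteq> outer b" "outer a \<noteq> outer c" "outer b \<noteq> outer c"
    using dist V by (simp_all add: outer_eq_iff)
  have "triangle (outer a) = {outer a, outer b, outer c}"
    using dist' V self_in_triangle[of "outer a"] self_in_triangle[of "outer b"]
      self_in_triangle[of "outer c"] same
    by (intro card_3_eqI card_triangle triangle_in_P) simp_all
  note T' = this this[folded same(1)] this[folded same(2)]
  have N: "neighbours G a = {outer a, b, c}" "neighbours G b = {outer b, a, c}"
    "neighbours G c = {outer c, a, b}" "neighbours G (outer a) = {a, outer b, outer c}"
    "neighbours G (outer b) = {b, outer a, outer c}"
    "neighbours G (outer c) = {c, outer a, outer b}"
    using dist dist' V T T' by (auto simp: neighbours_eq)
  have ne: "outer u \<notin> {a, b, c}" if "u \<in> {a, b, c}" for u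
    using that T V outer_notin_triangle[of u] by auto
  \<comment> \<open>Even positions carry one triangle, odd positions the other, and vertices joined
    by an outer edge sit three positions apart.\<close>
  let ?f = "(!) [a, outer c, b, outer a, c, outer b]"
  show ?thesis
  proof (rule digraph_isoI)
    show "inj_on ?f (pverts complement_C6)"
      using dist dist' ne[of a] ne[of b] ne[of c]
      by (auto simp add: pverts_complement_C6)
    show "?f ` pverts complement_C6 \<subseteq> verts G"
      using V by (simp add: pverts_complement_C6)
    show "?f u \<rightarrow> ?f v" if "(u, v) \<in> parcs complement_C6" for u v
      using that N unfolding parcs_complement_C6 in_neighbours_iff[symmetric] by auto
    show "neighbours G (?f u) \<subseteq> ?f ` {v. (u, v) \<in> parcs complement_C6}"
      if "u \<in> pverts complement_C6" for u
      using that N unfolding pverts_complement_C6 parcs_complement_C6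
      by (auto simp: image_iff ex_disj_distrib conj_disj_distribR)
  qed (auto simp: pverts_complement_C6 parcs_complement_C6)
qed

end

section \<open>The cycle of prisms\<close>

locale prism_free_partition = triangle_partition +
  assumes prism_free:
    "C \<in> P \<Longrightarrow> \<exists>a \<in> C. \<exists>b \<in> C. triangle (outer a) \<noteq> triangle (outer b)"
begin

section \<open>Ports, their sides, and the ports of partner triangles\<close>

definition port_with :: "'a \<Rightarrow> 'a \<Rightarrow> 'a \<Rightarrow> bool" where
  "port_with x y z \<longleftrightarrow> x \<in> verts G \<and> triangle x = {x, y, z} \<and> x \<noteq> y \<and> x \<noteq> z \<and> y \<noteq> z \<and>
    triangle (outer y) = triangle (outer z)"

definition port :: "'a \<Rightarrow> bool" where
  "port x \<longleftrightarrow> (\<exists>y z. port_with x y z)"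

text \<open>The two sides of a port are interchangeable; the choice only names them. It is made
  separately at each port, so the names at \<open>x\<close> and at \<open>twin x\<close> need not
  correspond.\<close>

definition left :: "'a \<Rightarrow> 'a" where
  "left x = (SOME y. \<exists>z. port_with x y z)"

definition right :: "'a \<Rightarrow> 'a" where
  "right x = (SOME z. port_with x (left x) z)"

definition twin :: "'a \<Rightarrow> 'a" where
  "twin x = (THE w. port w \<and> triangle w = triangle (outer (left x)))"

lemma port_with_sides: "port x \<Longrightarrow> port_with x (left x) (right x)"
  unfolding port_def left_def right_def by (rule someI_ex) (rule someI_ex)

lemma portI: "port_with x y z \<Longrightarrow> port x"
  by (auto simp: port_def)

lemma port_verts:
  assumes "port x"
  shows "x \<in> verts G" "left x \<in> verts G" "right x \<in> verts G"
  using port_with_sides[OF assms] triangle_vertsD[of x x "left x" "right x"]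
  by (simp_all add: port_with_def)

lemma triangle_port: "port x \<Longrightarrow> triangle x = {x, left x, right x}"
  and port_distinct: "port x \<Longrightarrow> x \<noteq> left x \<and> x \<noteq> right x \<and> left x \<noteq> right x"
  and triangle_outer_right: "port x \<Longrightarrow> triangle (outer (right x)) = triangle (outer (left x))"
  using port_with_sides[of x] by (simp_all add: port_with_def)

lemma triangle_left: "port x \<Longrightarrow> triangle (left x) = triangle x"
  and triangle_right: "port x \<Longrightarrow> triangle (right x) = triangle x"
  using triangle_port[of x] triangle_eq[OF port_verts(1), of x "left x"]
    triangle_eq[OF port_verts(1), of x "right x"] by simp_all

text \<open>Otherwise all three outer neighbours would share a triangle, which
  \<open>prism_free\<close> excludes.\<close>

lemma triangle_outer_port_ne:
  assumes x: "port x"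
  shows "triangle (outer x) \<noteq> triangle (outer (left x))"
proof
  assume "triangle (outer x) = triangle (outer (left x))"
  then have "triangle (outer a) = triangle (outer (left x))" if "a \<in> triangle x" for a
    using that x triangle_port[OF x] triangle_outer_right[OF x] by auto
  then show False
    using prism_free[OF triangle_in_P[OF port_verts(1)[OF x]]] by metis
qed

text \<open>Two different ports of one triangle would give two overlapping pairs of vertices with
  outer neighbours in a common triangle, so all three outer neighbours would share it.\<close>

lemma port_unique:
  assumes x: "port x" and w: "port w" and eq: "triangle x = triangle w"
  shows "w = x"
proof (rule ccontr)
  assume "w \<noteq> x"
  have "w \<in> triangle x"
    using eq self_in_triangle[OF port_verts(1)[OF w]] by simp
  then have "w \<in> {left x, right x}"
    using \<open>w \<noteq> x\<close> unfolding triangle_port[OF x] by simp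
  then have 1: "triangle (outer w) = triangle (outer (left x))"
    using triangle_outer_right[OF x] by auto
  have "x \<in> triangle w"
    using eq self_in_triangle[OF port_verts(1)[OF x]] by simp
  then have "x \<in> {left w, right w}"
    using \<open>w \<noteq> x\<close> unfolding triangle_port[OF w] by simp
  then have 2: "triangle (outer x) = triangle (outer (left w))"
    using triangle_outer_right[OF w] by auto
  \<comment> \<open>The third vertex of the triangle is a side with respect to both ports and links
    the two equalities.\<close>
  obtain t where t: "t \<in> {left x, right x}" "t \<noteq> w"
    using port_distinct[OF x] by auto
  then have "t \<in> triangle w"
    unfolding eq[symmetric] triangle_port[OF x] by simp
  then have "t \<in> {left w, right w}"
    using t(2) unfolding triangle_port[OF w] by simp
  then have "triangle (outer (left x)) = triangle (outer (left w))"
    using t(1) triangle_outer_right[OF x] triangle_outer_right[OF w] by auto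
  then show False
    using 2 triangle_outer_port_ne[OF x] by simp
qed

text \<open>The partner triangle contains the outer neighbours of both sides of \<open>x\<close>.
  Their own outer neighbours are those sides again, in one triangle, so the remaining vertex
  \<open>w\<close> is a port.\<close>

lemma twin_props:
  assumes x: "port x"
  shows port_twin: "port (twin x)"
    and triangle_twin: "triangle (twin x) = triangle (outer (left x))"
    and triangle_twin_eq: "triangle (twin x) = {twin x, outer (left x), outer (right x)}"
    and twin_distinct: "twin x \<noteq> outer (left x)" "twin x \<noteq> outer (right x)"
      "outer (left x) \<noteq> outer (right x)"
proof -
  let ?D = "triangle (outer (left x))"
  note V = port_verts[OF x]
  have D: "?D \<in> P"
    using V by (simp add: triangle_in_P)
  have ab: "outer (left x) \<in> ?D" "outer (right x) \<in> ?D"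
    using V self_in_triangle[of "outer (left x)"] self_in_triangle[of "outer (right x)"]
    by (simp_all add: triangle_outer_right[OF x])
  have ne: "outer (left x) \<noteq> outer (right x)"
    using V port_distinct[OF x] by (simp add: outer_eq_iff)
  obtain w where w: "?D = {outer (left x), outer (right x), w}"
      "w \<noteq> outer (left x)" "w \<noteq> outer (right x)"
    using card_triangle[OF D] ab ne by (rule card_3_extendE)
  then have wV: "w \<in> verts G" "triangle w = ?D"
    using V triangle_subset_verts[of "outer (left x)"] triangle_eq[of "outer (left x)" w] by auto
  then have "port_with w (outer (left x)) (outer (right x))"
    using w ne V triangle_left[OF x] triangle_right[OF x] by (auto simp: port_with_def)
  then have "port w" by (rule portI)
  then have "twin x = w"
    unfolding twin_def using wV(2) port_unique by (intro the_equality) auto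
  then show "port (twin x)" "triangle (twin x) = ?D"
    "triangle (twin x) = {twin x, outer (left x), outer (right x)}"
    "twin x \<noteq> outer (left x)" "twin x \<noteq> outer (right x)" "outer (left x) \<noteq> outer (right x)"
    using \<open>port w\<close> w wV(2) ne by auto
qed

lemma twin_eqI: "port x \<Longrightarrow> port w \<Longrightarrow> triangle w = triangle (outer (left x)) \<Longrightarrow> twin x = w"
  using port_unique port_twin triangle_twin by metis

text \<open>Stated for sets because the sides of \<open>twin x\<close> may be named in either
  order.\<close>

lemma sides_twin:
  assumes x: "port x"
  shows "{left (twin x), right (twin x)} = {outer (left x), outer (right x)}"
proof -
  have "{left (twin x), right (twin x)} = triangle (twin x) - {twin x}"
    using triangle_port[OF port_twin[OF x]] port_distinct[OF port_twin[OF x]] by auto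
  also have "\<dots> = {outer (left x), outer (right x)}"
    using triangle_twin_eq[OF x] twin_distinct[OF x] by auto
  finally show ?thesis .
qed

lemma twin_twin:
  assumes x: "port x"
  shows "twin (twin x) = x"
proof (rule twin_eqI)
  have "left (twin x) = outer (left x) \<or> left (twin x) = outer (right x)"
    using sides_twin[OF x] by auto
  then show "triangle x = triangle (outer (left (twin x)))"
    using port_verts[OF x] triangle_left[OF x] triangle_right[OF x] by auto
qed (use x port_twin in auto)

lemma triangle_twin_ne: "port x \<Longrightarrow> triangle (twin x) \<noteq> triangle x"
  using triangle_twin triangle_left triangle_outer_ne port_verts by metis

text \<open>Let \<open>q\<close> be the port of the triangle of \<open>outer x\<close>. If
  \<open>outer x\<close> were a side of \<open>q\<close>, then \<open>x\<close> and \<open>q\<close>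
  would be twins, and the outer neighbour of \<open>x\<close> would lie in its partner
  triangle.\<close>

lemma port_outer:
  assumes x: "port x"
  shows "port (outer x)"
proof -
  note V = port_verts[OF x]
  let ?C = "triangle (outer x)"
  have C: "?C \<in> P" using V by (simp add: triangle_in_P)
  obtain a b where ab: "a \<in> ?C" "b \<in> ?C" "a \<noteq> b" "triangle (outer a) = triangle (outer b)"
    using C by (rule twin_outerE)
  obtain q where q: "?C = {a, b, q}" "q \<noteq> a" "q \<noteq> b"
    using card_triangle[OF C] ab(1-3) by (rule card_3_extendE)
  have "q \<in> verts G" "triangle q = ?C"
    using q V triangle_subset_verts[of "outer x"] triangle_eq[of "outer x" q] by auto
  then have qab: "port_with q a b"
    using q ab by (auto simp: port_with_def)
  then have pq: "port q" by (rule portI)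
  have "q = outer x"
  proof (rule ccontr)
    assume "q \<noteq> outer x"
    then have "outer x \<in> {left q, right q}"
      using self_in_triangle[of "outer x"] V(1)
      unfolding \<open>triangle q = ?C\<close>[symmetric] triangle_port[OF pq] by auto
    then consider "outer x = left q" | "outer x = right q" by blast
    then have "triangle (outer (outer x)) = triangle (outer (left q))"
    proof cases
      case 1
      then show ?thesis by (rule arg_cong)
    next
      case 2
      show ?thesis unfolding 2 by (rule triangle_outer_right[OF pq])
    qed
    then have "twin q = x"
      unfolding outer_outer[OF V(1)] by (rule twin_eqI[OF pq x])
    then have "twin x = q"
      using twin_twin[OF pq] by simp
    then show False
      using triangle_twin[OF x] \<open>triangle q = ?C\<close> triangle_outer_port_ne[OF x] by simp
  qed
  then show ?thesis using pq by simp
qed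

section \<open>The rotation that moves from one pair of triangles to the next, and its
  orbits\<close>

definition rot :: "'a \<Rightarrow> 'a" where
  "rot x = twin (outer x)"

lemma port_rot: "port x \<Longrightarrow> port (rot x)"
  by (simp add: rot_def port_outer port_twin)

lemma port_rot_pow: "port x \<Longrightarrow> port ((rot ^^ m) x)"
  by (induction m) (simp_all add: port_rot)

lemma twin_rot: "port x \<Longrightarrow> twin (rot x) = outer x"
  by (simp add: rot_def port_outer twin_twin)

lemma rot_inject:
  assumes "port x" "port w" "rot x = rot w"
  shows "x = w"
  using twin_rot[OF assms(1)] twin_rot[OF assms(2)] assms(3) outer_eq_iff port_verts(1) assms(1,2)
  by metis

lemma rot_pow_inject:
  "port x \<Longrightarrow> port w \<Longrightarrow> (rot ^^ m) x = (rot ^^ m) w \<Longrightarrow> x = w"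
  by (induction m) (auto dest!: rot_inject[rotated 2] simp: port_rot_pow)

text \<open>The maps \<open>twin\<close> and \<open>outer\<close> generate a dihedral action on the ports, and a
  reflection \<open>twin \<circ> rot ^^ m\<close> with a fixed point would be conjugate to one of the
  two generators, neither of which fixes a port.\<close>

lemma rot_pow_ne_twin: "port x \<Longrightarrow> (rot ^^ m) x \<noteq> twin x"
proof (induction m arbitrary: x rule: induct_nat_012)
  case 0
  then show ?case using triangle_twin_ne by force
next
  case 1
  have False if "rot x = twin x"
  proof -
    have "outer x = x"
      using that twin_rot[OF 1] twin_twin[OF 1] by simp
    then show False
      using triangle_outer_ne port_verts(1)[OF 1] by metis
  qed
  then show ?case by auto
next
  case (ge2 m)
  \<comment> \<open>Undoing the last rotation and shifting the first into the starting point leaves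
    the same claim for \<open>rot x\<close> with exponent \<open>m\<close>.\<close>
  have "rot ((rot ^^ m) (rot x)) \<noteq> twin x"
  proof
    assume "rot ((rot ^^ m) (rot x)) = twin x"
    then have "outer ((rot ^^ m) (rot x)) = x"
      using twin_rot[OF port_rot_pow[OF port_rot[OF ge2(3)], of m]] twin_twin[OF ge2(3)] by simp
    then have "(rot ^^ m) (rot x) = outer x"
      using outer_outer port_verts(1) port_rot_pow port_rot ge2(3) by metis
    then show False
      using ge2(1)[OF port_rot[OF ge2(3)]] twin_rot[OF ge2(3)] by simp
  qed
  then show ?case by (simp add: funpow_swap1)
qed

text \<open>Finiteness gives a repetition in the orbit; injectivity of \<open>rot\<close> on ports
  shifts it back to the start, and the least period is taken.\<close>

lemma rot_periodE:
  assumes x: "port x"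
  obtains n where "n \<ge> 1" "(rot ^^ n) x = x" "\<And>m. 1 \<le> m \<Longrightarrow> m < n \<Longrightarrow> (rot ^^ m) x \<noteq> x"
proof -
  have "range (\<lambda>i. (rot ^^ i) x) \<subseteq> verts G"
    using port_rot_pow[OF x] port_verts(1) by blast
  then have "finite (range (\<lambda>i. (rot ^^ i) x))"
    by (rule finite_subset) simp
  then have "\<not> inj (\<lambda>i. (rot ^^ i) x)"
    using finite_imageD infinite_UNIV_nat by blast
  then obtain i j where ij: "i < j" "(rot ^^ i) x = (rot ^^ j) x"
    unfolding inj_def by (metis linorder_neqE_nat)
  then have "(rot ^^ i) x = (rot ^^ i) ((rot ^^ (j - i)) x)"
    by (simp flip: funpow_add[THEN fun_cong, unfolded comp_def])
  then have "(rot ^^ (j - i)) x = x"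
    using rot_pow_inject x port_rot_pow by metis
  then have ex: "\<exists>n. n \<ge> 1 \<and> (rot ^^ n) x = x"
    using ij(1) by (intro exI[of _ "j - i"]) simp
  let ?n = "LEAST n. n \<ge> 1 \<and> (rot ^^ n) x = x"
  show ?thesis
    using LeastI_ex[OF ex] not_less_Least[of _ "\<lambda>n. n \<ge> 1 \<and> (rot ^^ n) x = x"]
    by (intro that[of ?n]) blast+
qed

section \<open>Neighbourhoods in a pair of triangles, and the embedding of the model\<close>

lemma neighbours_port:
  assumes x: "port x"
  shows "neighbours G x = {outer x, left x, right x}"
    and "neighbours G (left x) = {outer (left x), x, right x}"
    and "neighbours G (right x) = {outer (right x), x, left x}"
    and "neighbours G (twin x) = {outer (twin x), outer (left x), outer (right x)}"
    and "neighbours G (outer (left x)) = {left x, twin x, outer (right x)}"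
    and "neighbours G (outer (right x)) = {right x, twin x, outer (left x)}"
proof -
  note V = port_verts[OF x] port_verts(1)[OF port_twin[OF x]]
  note D = port_distinct[OF x] twin_distinct[OF x]
  have T: "triangle (outer (left x)) = {twin x, outer (left x), outer (right x)}"
    "triangle (outer (right x)) = {twin x, outer (left x), outer (right x)}"
    using triangle_twin[OF x] triangle_twin_eq[OF x] triangle_outer_right[OF x] by simp_all
  show "neighbours G x = {outer x, left x, right x}"
    "neighbours G (left x) = {outer (left x), x, right x}"
    "neighbours G (right x) = {outer (right x), x, left x}"
    using V D unfolding neighbours_eq[OF V(1)] neighbours_eq[OF V(2)] neighbours_eq[OF V(3)]
      triangle_left[OF x] triangle_right[OF x] triangle_port[OF x] by auto
  show "neighbours G (twin x) = {outer (twin x), outer (left x), outer (right x)}"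
    using D unfolding neighbours_eq[OF V(4)] triangle_twin_eq[OF x] by auto
  show "neighbours G (outer (left x)) = {left x, twin x, outer (right x)}"
    using D unfolding neighbours_eq[OF outer_in_verts[OF V(2)]] T outer_outer[OF V(2)] by auto
  show "neighbours G (outer (right x)) = {right x, twin x, outer (left x)}"
    using D unfolding neighbours_eq[OF outer_in_verts[OF V(3)]] T outer_outer[OF V(3)] by auto
qed

text \<open>Unprimed vertices go to the triangle of the port \<open>s i\<close>, primed ones to its
  partner. The primed sides are outer neighbours of the sides of \<open>s i\<close>, not the chosen
  sides of the twin, so that the two matching edges are preserved.\<close>

primrec embedding :: "(nat \<Rightarrow> 'a) \<Rightarrow> F_vertex \<Rightarrow> 'a" where
  "embedding s (VX i) = s i"
| "embedding s (VX' i) = twin (s i)"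
| "embedding s (VY i) = left (s i)"
| "embedding s (VY' i) = outer (left (s i))"
| "embedding s (VZ i) = right (s i)"
| "embedding s (VZ' i) = outer (right (s i))"

lemma inj_on_embedding:
  assumes port: "\<And>i. i \<in> {1..n} \<Longrightarrow> port (s i)"
    and inj: "inj_on s {1..n}"
    and ne: "\<And>i j. i \<in> {1..n} \<Longrightarrow> j \<in> {1..n} \<Longrightarrow> s i \<noteq> twin (s j)"
  shows "inj_on (embedding s) (pverts (F_graph n))"
proof (rule inj_onI)
  fix u v assume uv: "u \<in> pverts (F_graph n)" "v \<in> pverts (F_graph n)"
    and eq: "embedding s u = embedding s v"
  \<comment> \<open>A block names one of the 2n triangles of the model, and \<open>base\<close> is
    the port of its image. Equal images lie in one triangle, hence have one port and one block;
    inside a block the three images are distinct.\<close>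
  define block :: "F_vertex \<Rightarrow> nat \<times> bool" where
    "block v = (case v of VX i \<Rightarrow> (i, False) | VY i \<Rightarrow> (i, False) | VZ i \<Rightarrow> (i, False)
      | VX' i \<Rightarrow> (i, True) | VY' i \<Rightarrow> (i, True) | VZ' i \<Rightarrow> (i, True))" for v
  define base where "base k = (if snd k then twin (s (fst k)) else s (fst k))" for k :: "nat \<times> bool"
  have tri: "triangle (embedding s w) = triangle (base (block w))"
    and index: "fst (block w) \<in> {1..n}" if "w \<in> pverts (F_graph n)" for w
    using that port triangle_left triangle_right triangle_twin triangle_outer_right
    by (cases w; simp add: pverts_F block_def base_def)+
  have port_base: "port (base k)" if "fst k \<in> {1..n}" for k
    using that port port_twin by (simp add: base_def)
  have base_inj: "k = l" if "fst k \<in> {1..n}" "fst l \<in> {1..n}" "base k = base l" for k l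
  proof -
    have "snd k = snd l"
      using that ne[of "fst k" "fst l"] ne[of "fst l" "fst k"]
      by (auto simp: base_def split: if_splits)
    moreover from this have "s (fst k) = s (fst l)"
      using that port twin_twin by (auto simp: base_def split: if_splits) metis
    then have "fst k = fst l"
      using that inj by (auto dest: inj_onD)
    ultimately show ?thesis by (simp add: prod_eq_iff)
  qed
  have "base (block u) = base (block v)"
    using tri[OF uv(1)] tri[OF uv(2)] eq index[OF uv(1)] index[OF uv(2)] port_base port_unique
    by metis
  then have "block u = block v"
    using base_inj index uv by blast
  moreover have "fst (block u) \<in> {1..n}" by (rule index[OF uv(1)])
  ultimately show "u = v"
    using eq port_distinct[OF port, of "fst (block u)"] twin_distinct[OF port, of "fst (block u)"]
    by (cases u; cases v) (simp_all add: block_def)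
qed

text \<open>The hypotheses make the ports \<open>s i\<close> and their twins 2n distinct ports, with
  outer edges closing them up cyclically; the rest is a comparison of neighbourhoods.\<close>

lemma cycle_of_prisms_iso_F:
  assumes ports: "\<And>i. i \<in> {1..n} \<Longrightarrow> port (s i)" and n: "n \<ge> 1"
    and inj: "inj_on s {1..n}"
    and ne: "\<And>i j. i \<in> {1..n} \<Longrightarrow> j \<in> {1..n} \<Longrightarrow> s i \<noteq> twin (s j)"
    and succ: "\<And>i. i \<in> {1..n} \<Longrightarrow> outer (s i) = twin (s (i mod n + 1))"
  shows "digraph_iso G (with_proj (F_graph n))"
proof (rule digraph_isoI)
  interpret F: pair_graph "F_graph n" by (rule pair_graph_F_graph)
  show wf: "parcs (F_graph n) \<subseteq> pverts (F_graph n) \<times> pverts (F_graph n)"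
    using F.wellformed' by auto
  show "pverts (F_graph n) \<noteq> {}"
    using n by (auto simp: pverts_F)
  show "inj_on (embedding s) (pverts (F_graph n))"
    using ports inj ne by (rule inj_on_embedding)
  show "embedding s ` pverts (F_graph n) \<subseteq> verts G"
    using ports port_verts port_twin by (auto simp: pverts_F)
  \<comment> \<open>The cyclic predecessor: index 1 is preceded by \<open>n\<close>.\<close>
  have pred: "\<exists>j \<in> {1..n}. i = j mod n + 1" if "i \<in> {1..n}" for i
    using that by (intro bexI[of _ "if i = 1 then n else i - 1"]) auto
  have N: "neighbours G (embedding s u) = embedding s ` {v. (u, v) \<in> parcs (F_graph n)}"
    if "u \<in> pverts (F_graph n)" for u
  proof (cases u)
    case (VX' i)
    then have i: "i \<in> {1..n}" using that by (auto simp: pverts_F)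
    have out: "outer (twin (s (j mod n + 1))) = s j" if "j \<in> {1..n}" for j
      using succ[OF that] ports[OF that] port_verts(1) by (metis outer_outer)
    obtain j where j: "j \<in> {1..n}" "i = j mod n + 1"
      using pred[OF i] by auto
    \<comment> \<open>Any two predecessor indices give the same port, namely the outer neighbour of
      \<open>twin (s i)\<close>; this collapses the existential clause of \<open>parcs_F\<close> to
      one vertex.\<close>
    have "s k = s j" if "k \<in> {1..n}" "i = k mod n + 1" for k
      using out[OF that(1)] out[OF j(1)] that(2) j(2) by simp
    then have "s ` {k \<in> {1..n}. i = k mod n + 1} = {s j}"
      using j by blast
    moreover have "{v. (u, v) \<in> parcs (F_graph n)} =
        {VY' i, VZ' i} \<union> VX ` {k \<in> {1..n}. i = k mod n + 1}"
      using i unfolding VX' parcs_F by blast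
    ultimately have "embedding s ` {v. (u, v) \<in> parcs (F_graph n)} =
        {s j, outer (left (s i)), outer (right (s i))}"
      by (auto simp: image_Un image_image)
    then show ?thesis
      using neighbours_port(4)[OF ports[OF i]] out[OF j(1)] j(2) VX' by simp
  next
    case (VX i)
    then have i: "i \<in> {1..n}" using that by (auto simp: pverts_F)
    have "{v. (u, v) \<in> parcs (F_graph n)} = {VX' (i mod n + 1), VY i, VZ i}"
      using i unfolding VX parcs_F by auto
    then show ?thesis
      using neighbours_port(1)[OF ports[OF i]] succ[OF i] VX by simp
  next
    case (VY i)
    then have i: "i \<in> {1..n}" using that by (auto simp: pverts_F)
    have "{v. (u, v) \<in> parcs (F_graph n)} = {VY' i, VX i, VZ i}"
      using i unfolding VY parcs_F by auto
    then show ?thesis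
      using neighbours_port(2)[OF ports[OF i]] VY by simp
  next
    case (VZ i)
    then have i: "i \<in> {1..n}" using that by (auto simp: pverts_F)
    have "{v. (u, v) \<in> parcs (F_graph n)} = {VZ' i, VX i, VY i}"
      using i unfolding VZ parcs_F by auto
    then show ?thesis
      using neighbours_port(3)[OF ports[OF i]] VZ by simp
  next
    case (VY' i)
    then have i: "i \<in> {1..n}" using that by (auto simp: pverts_F)
    have "{v. (u, v) \<in> parcs (F_graph n)} = {VY i, VX' i, VZ' i}"
      using i unfolding VY' parcs_F by auto
    then show ?thesis
      using neighbours_port(5)[OF ports[OF i]] VY' by simp
  next
    case (VZ' i)
    then have i: "i \<in> {1..n}" using that by (auto simp: pverts_F)
    have "{v. (u, v) \<in> parcs (F_graph n)} = {VZ i, VX' i, VY' i}"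
      using i unfolding VZ' parcs_F by auto
    then show ?thesis
      using neighbours_port(6)[OF ports[OF i]] VZ' by simp
  qed
  show "neighbours G (embedding s u) \<subseteq> embedding s ` {v. (u, v) \<in> parcs (F_graph n)}"
    if "u \<in> pverts (F_graph n)" for u
    using N[OF that] by simp
  show "embedding s u \<rightarrow> embedding s v" if uv: "(u, v) \<in> parcs (F_graph n)" for u v
  proof -
    have "embedding s v \<in> neighbours G (embedding s u)"
      using N[of u] uv wf by blast
    then show ?thesis by (simp add: in_neighbours_iff)
  qed
qed

lemma iso_F: "\<exists>n \<ge> 2. digraph_iso G (with_proj (F_graph n))"
proof -
  have "verts G \<noteq> {}"
    using connected by (simp add: connected_conv)
  then obtain C where C: "C \<in> P"
    using part by (auto simp: partition_on_def)
  obtain a b where ab: "a \<in> C" "b \<in> C" "a \<noteq> b" "triangle (outer a) = triangle (outer b)"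
    using C by (rule twin_outerE)
  obtain x where x: "C = {a, b, x}" "x \<noteq> a" "x \<noteq> b"
    using card_triangle[OF C] ab(1-3) by (rule card_3_extendE)
  have "x \<in> verts G" "triangle x = C"
    using x(1) C part triangle_eqI[OF C, of x] by (auto simp: partition_on_def)
  then have "port_with x a b"
    using x ab by (auto simp: port_with_def)
  then have px: "port x" by (rule portI)
  obtain n where n: "n \<ge> 1" "(rot ^^ n) x = x"
    and min: "\<And>m. 1 \<le> m \<Longrightarrow> m < n \<Longrightarrow> (rot ^^ m) x \<noteq> x"
    using rot_periodE[OF px] by blast
  \<comment> \<open>Period one would make \<open>twin x\<close> the outer neighbour of
    \<open>x\<close>, that is, join the pair by a third edge.\<close>
  have "n \<noteq> 1"
  proof
    assume "n = 1"
    then have "twin x = outer x"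
      using n(2) twin_rot[OF px] by simp
    then show False
      using triangle_twin[OF px] triangle_outer_port_ne[OF px] by simp
  qed
  then have "n \<ge> 2" using n(1) by simp
  \<comment> \<open>The shift by one matches the index set starting at 1, so \<open>s 1\<close> is
    \<open>x\<close>.\<close>
  define s where "s i = (rot ^^ (i - 1)) x" for i
  have ports: "port (s i)" for i
    by (simp add: s_def port_rot_pow px)
  have step: "s j = (rot ^^ (j - i)) (s i)" if "1 \<le> i" "i \<le> j" for i j
  proof -
    have "j - 1 = (j - i) + (i - 1)" using that by simp
    then show ?thesis by (simp add: s_def funpow_add)
  qed
  have "s i \<noteq> s j" if "1 \<le> i" "i < j" "j \<le> n" for i j
  proof
    assume "s i = s j"
    moreover have "j - 1 = (i - 1) + (j - i)" using that by simp
    ultimately have "(rot ^^ (i - 1)) x = (rot ^^ (i - 1)) ((rot ^^ (j - i)) x)"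
      by (simp add: s_def funpow_add)
    then have "x = (rot ^^ (j - i)) x"
      using rot_pow_inject[OF px port_rot_pow[OF px]] by blast
    then have "(rot ^^ (j - i)) x = x" by (rule sym)
    then show False using min[of "j - i"] that by simp
  qed
  then have "inj_on s {1..n}"
    by (intro linorder_inj_onI) auto
  \<comment> \<open>The port with the larger index is a rotation of the other, hence not its twin;
    since \<open>twin\<close> is an involution, the order of the two does not matter.\<close>
  moreover have "s i \<noteq> twin (s j)" if "i \<in> {1..n}" "j \<in> {1..n}" for i j
  proof (cases "i \<le> j")
    case True
    then have "s j \<noteq> twin (s i)"
      using rot_pow_ne_twin[OF ports] step[of i j] that by simp
    then show ?thesis using twin_twin[OF ports] by metis
  next
    case False
    then show ?thesis
      using rot_pow_ne_twin[OF ports] step[of j i] that by simp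
  qed
  moreover have "outer (s i) = twin (s (i mod n + 1))" if i: "i \<in> {1..n}" for i
  proof -
    have "rot (s i) = (rot ^^ i) x"
      using i by (cases i) (simp_all add: s_def)
    \<comment> \<open>At \<open>i = n\<close> the cycle closes because \<open>n\<close> is a period
      of \<open>x\<close>.\<close>
    also have "\<dots> = s (i mod n + 1)"
      using i n(2) by (cases "i = n") (simp_all add: s_def)
    finally show ?thesis using twin_rot[OF ports] by metis
  qed
  ultimately have "digraph_iso G (with_proj (F_graph n))"
    using ports n(1) by (intro cycle_of_prisms_iso_F) auto
  then show ?thesis using \<open>n \<ge> 2\<close> by blast
qed

end

section \<open>Assembling the classification\<close>

lemma (in triangle_partition) classification:
  "digraph_iso G (with_proj complement_C6) \<or> (\<exists>n \<ge> 2. digraph_iso G (with_proj (F_graph n)))"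
proof (cases "\<exists>C \<in> P. \<forall>a \<in> C. \<forall>b \<in> C. triangle (outer a) = triangle (outer b)")
  case True
  then obtain C where C: "C \<in> P"
    and same: "\<And>a b. a \<in> C \<Longrightarrow> b \<in> C \<Longrightarrow> triangle (outer a) = triangle (outer b)"
    by blast
  obtain a b c where abc: "C = {a, b, c}" "a \<noteq> b" "a \<noteq> c" "b \<noteq> c"
    using card_triangle[OF C] by (auto simp: card_3_iff)
  then have "digraph_iso G (with_proj complement_C6)"
    using C same[of b a] same[of c a] by (intro prism_iso_complement_C6[of a b c]) simp_all
  then show ?thesis ..
next
  case False
  then interpret prism_free_partition G P
    by unfold_locales simp
  show ?thesis using iso_F ..
qed

text \<open>Case distinction on the sizes of the parts: a single part of size two, or of size at
  least four, already determines the graph; otherwise all parts are triangles.\<close>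

lemma (in connected_cubic_graph) localizable_imp_listed:
  assumes "localizable G"
  shows "K\<^bsub>3,3\<^esub> G \<or> K\<^bsub>4\<^esub> G \<or> digraph_iso G (with_proj complement_C6) \<or>
    (\<exists>n \<ge> 2. digraph_iso G (with_proj (F_graph n)))"
proof -
  obtain P where P: "partition_on (verts G) P" "\<And>C. C \<in> P \<Longrightarrow> strong_clique G C"
    using assms by (auto simp: localizable_def)
  have card: "card C \<noteq> 0" "card C \<noteq> 1" if "C \<in> P" for C
  proof -
    have "C \<subseteq> verts G" "C \<noteq> {}"
      using P(1) that by (auto simp: partition_on_def)
    then show "card C \<noteq> 0"
      using finite_subset[OF _ finite_verts] by auto
    show "card C \<noteq> 1"
      using P(2)[OF that] by (rule strong_clique_card_ne_1)
  qed
  consider C where "C \<in> P" "card C = 2" | C where "C \<in> P" "card C \<ge> 4"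
    | "\<And>C. C \<in> P \<Longrightarrow> card C = 3"
  proof -
    have "card C = 2 \<or> card C = 3 \<or> card C \<ge> 4" if "C \<in> P" for C
      using card[OF that] by linarith
    then show thesis using that by blast
  qed
  then show ?thesis
  proof cases
    case 1
    then show ?thesis using strong_edge_imp_K33[of C] P(2)[of C] by simp
  next
    case 2
    then show ?thesis using clique_4_imp_K4[of C] P(2)[of C] by (simp add: strong_clique_def)
  next
    case 3
    interpret triangle_partition G P
      using P 3 by unfold_locales
    show ?thesis using classification by simp
  qed
qed

theorem theorem6p6:
  fixes G :: "('a, 'b) pre_digraph"
  assumes "graph G" and "connected G" and "cubic G"
  shows "localizable G \<longleftrightarrow>
    K\<^bsub>3,3\<^esub> G \<or> K\<^bsub>4\<^esub> G \<or>
    digraph_iso G (with_proj (complement_graph (with_proj (cycle_graph 6)))) \<or>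
    (\<exists>n \<ge> 2. digraph_iso G (with_proj (F_graph n)))"
proof -
  interpret graph G by (rule assms(1))
  interpret connected_cubic_graph G
    using assms(2,3) by unfold_locales
  show ?thesis
  proof
    assume "localizable G"
    then show "K\<^bsub>3,3\<^esub> G \<or> K\<^bsub>4\<^esub> G \<or>
        digraph_iso G (with_proj (complement_graph (with_proj (cycle_graph 6)))) \<or>
        (\<exists>n \<ge> 2. digraph_iso G (with_proj (F_graph n)))"
      by (rule localizable_imp_listed)
  next
    assume "K\<^bsub>3,3\<^esub> G \<or> K\<^bsub>4\<^esub> G \<or>
        digraph_iso G (with_proj (complement_graph (with_proj (cycle_graph 6)))) \<or>
        (\<exists>n \<ge> 2. digraph_iso G (with_proj (F_graph n)))"
    then show "localizable G"
    proof (elim disjE exE conjE)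
      assume "K\<^bsub>3,3\<^esub> G"
      then show ?thesis by (rule localizable_complete_bipartite)
    next
      assume "K\<^bsub>4\<^esub> G"
      then show ?thesis by (rule localizable_complete) simp
    next
      assume "digraph_iso G (with_proj complement_C6)"
      then show ?thesis
        \<comment> \<open>The isomorphism is reversed, since localizability is carried from the
          model to \<open>G\<close>.\<close>
        by (rule localizable_iso[OF digraph_iso_swap[OF wf_digraph]])
          (rule localizable_complement_C6)
    next
      fix n assume "digraph_iso G (with_proj (F_graph n))"
      then show ?thesis
        by (rule localizable_iso[OF digraph_iso_swap[OF wf_digraph]])
          (rule localizable_F)
    qed
  qed
qed

end
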